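(* Let $b=5$, $\gamma\in(1/5,1)$, $\psi(x)=-2\pi\sin(2\pi x)$, and assume $e(1)=2$. Then $\sigma(1)<5\gamma$.
   Context: $\mathcal{A}=\{0,\dots,b-1\}$. $S(x,\mathbf{i})=\sum_{n\ge1}\gamma^{n-1}\psi\big(\frac{x+i_1+i_2b+\cdots+i_nb^{n-1}}{b^n}\big)$ for $\mathbf{i}\in\mathcal{A}^{\mathbb{Z}^+}$, $S'=\partial_xS$. For $\mathbf{u}\in\mathcal{A}^q$, $x(\mathbf{u})=(x+u_1+\cdots+u_qb^{q-1})/b^q$. Sequences $\mathbf{i},\mathbf{j}$ are $(\varepsilon,\delta)$-tangent at $x_0$ if $|S(x_0,\mathbf{i})-S(x_0,\mathbf{j})|\le\varepsilon$ and $|S'(x_0,\mathbf{i})-S'(x_0,\mathbf{j})|\le\delta$. $E(q,x_0;\varepsilon,\delta)$: pairs $(\mathbf{k},\mathbf{l})\in\mathcal{A}^q\times\mathcal{A}^q$ such that some concatenations $\mathbf{ku},\mathbf{lv}$ are $(\varepsilon,\delta)$-tangent at $x_0$. For $J\subset\mathbb{R}$: $E(q,J)=\bigcap_{\varepsilon,\delta>0}\bigcup_{x\in J}E(q,x;\varepsilon,\delta)$, $e(q,J)=\max_{\mathbf{k}}\#\{\mathbf{l}:(\mathbf{k},\mathbf{l})\in E(q,J)\}$, and $e(q)=\lim_{p\to\infty}\max_{0\le k<b^p}e(q,[k/b^p,(k+1)/b^p])$. Weight function: measurable $\omega:[0,1)\to(0,\infty)$ with $\omega,1/\omega$ bounded.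 Admissible testing function of order $q$: measurable $V:[0,1)\times\mathcal{A}^q\times\mathcal{A}^q\to[0,\infty)$ such that for some $\varepsilon,\delta>0$, $V(x,\mathbf{u},\mathbf{v})V(x,\mathbf{v},\mathbf{u})\ge1$ whenever $x\in[0,1)$ and $(\mathbf{u},\mathbf{v})\in E(q,x;\varepsilon,\delta)$. $\Sigma_{V,\omega}(x)=\sup_{\mathbf{u}}\frac{\omega(x)}{\omega(x(\mathbf{u}))}\sum_{\mathbf{v}}V(x,\mathbf{u},\mathbf{v})$; $\sigma(q)=\inf_{\omega,V}\|\Sigma_{V,\omega}\|_\infty$. *)

theory Defs
  imports "HOL-Analysis.Analysis" "HOL-Probability.Essential_Supremum"
begin

definition words :: "nat \<Rightarrow> nat \<Rightarrow> nat list set" where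
  "words b q = {k. length k = q \<and> set k \<subseteq> {..<b}}"

(* infinite sequences i_1 i_2 ... in A^{Z+}, stored 0-indexed: i_{n+1} = i n *)
definition seqs :: "nat \<Rightarrow> (nat \<Rightarrow> nat) set" where
  "seqs b = {i. \<forall>n. i n < b}"

definition conc :: "nat list \<Rightarrow> (nat \<Rightarrow> nat) \<Rightarrow> (nat \<Rightarrow> nat)" where
  "conc k u = (\<lambda>n. if n < length k then k ! n else u (n - length k))"

(* S(x,i) = sum_{n>=1} gamma^(n-1) psi((x + i_1 + i_2 b + ... + i_n b^(n-1))/b^n), reindexed n -> n+1 *)
definition S :: "nat \<Rightarrow> real \<Rightarrow> (real \<Rightarrow> real) \<Rightarrow> real \<Rightarrow> (nat \<Rightarrow> nat) \<Rightarrow> real" where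
  "S b \<gamma> \<psi> x i =
     (\<Sum>n. \<gamma> ^ n * \<psi> ((x + (\<Sum>m\<le>n. real (i m) * real b ^ m)) / real b ^ Suc n))"

definition Sd :: "nat \<Rightarrow> real \<Rightarrow> (real \<Rightarrow> real) \<Rightarrow> real \<Rightarrow> (nat \<Rightarrow> nat) \<Rightarrow> real" where
  "Sd b \<gamma> \<psi> x i = deriv (\<lambda>y. S b \<gamma> \<psi> y i) x"

definition tangent :: "nat \<Rightarrow> real \<Rightarrow> (real \<Rightarrow> real) \<Rightarrow> real \<Rightarrow> real \<Rightarrow> real
    \<Rightarrow> (nat \<Rightarrow> nat) \<Rightarrow> (nat \<Rightarrow> nat) \<Rightarrow> bool" where
  "tangent b \<gamma> \<psi> \<epsilon> \<delta> x0 i j \<longleftrightarrow>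
     \<bar>S b \<gamma> \<psi> x0 i - S b \<gamma> \<psi> x0 j\<bar> \<le> \<epsilon> \<and>
     \<bar>Sd b \<gamma> \<psi> x0 i - Sd b \<gamma> \<psi> x0 j\<bar> \<le> \<delta>"

definition Etan :: "nat \<Rightarrow> real \<Rightarrow> (real \<Rightarrow> real) \<Rightarrow> nat \<Rightarrow> real \<Rightarrow> real \<Rightarrow> real
    \<Rightarrow> (nat list \<times> nat list) set" where
  "Etan b \<gamma> \<psi> q x0 \<epsilon> \<delta> =
     {(k, l). k \<in> words b q \<and> l \<in> words b q \<and>
        (\<exists>u v. u \<in> seqs b \<and> v \<in> seqs b \<and> tangent b \<gamma> \<psi> \<epsilon> \<delta> x0 (conc k u) (conc l v))}"

definition EJ :: "nat \<Rightarrow> real \<Rightarrow> (real \<Rightarrow> real) \<Rightarrow> nat \<Rightarrow> real set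
    \<Rightarrow> (nat list \<times> nat list) set" where
  "EJ b \<gamma> \<psi> q J = (\<Inter>\<epsilon>\<in>{0<..}. \<Inter>\<delta>\<in>{0<..}. \<Union>x\<in>J. Etan b \<gamma> \<psi> q x \<epsilon> \<delta>)"

definition eJ :: "nat \<Rightarrow> real \<Rightarrow> (real \<Rightarrow> real) \<Rightarrow> nat \<Rightarrow> real set \<Rightarrow> nat" where
  "eJ b \<gamma> \<psi> q J = Max ((\<lambda>k. card {l \<in> words b q. (k, l) \<in> EJ b \<gamma> \<psi> q J}) ` words b q)"

(* the p-th term of the sequence whose limit is e(q) *)
definition e_seq :: "nat \<Rightarrow> real \<Rightarrow> (real \<Rightarrow> real) \<Rightarrow> nat \<Rightarrow> nat \<Rightarrow> nat" where
  "e_seq b \<gamma> \<psi> q p =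
     Max ((\<lambda>k. eJ b \<gamma> \<psi> q {real k / real b ^ p .. (real k + 1) / real b ^ p}) ` {..<b ^ p})"

definition xu :: "nat \<Rightarrow> nat \<Rightarrow> real \<Rightarrow> nat list \<Rightarrow> real" where
  "xu b q x u = (x + (\<Sum>m<q. real (u ! m) * real b ^ m)) / real b ^ q"

definition weight :: "(real \<Rightarrow> real) \<Rightarrow> bool" where
  "weight \<omega> \<longleftrightarrow> \<omega> \<in> borel_measurable (restrict_space lborel {0..<1}) \<and>
     (\<forall>x\<in>{0..<1}. \<omega> x > 0) \<and>
     (\<exists>M. \<forall>x\<in>{0..<1}. \<omega> x \<le> M \<and> 1 / \<omega> x \<le> M)"

(* admissible testing function of order q (measurability on [0,1) x A^q x A^q with A^q discrete
   is measurability of each section) *)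
definition admissible :: "nat \<Rightarrow> real \<Rightarrow> (real \<Rightarrow> real) \<Rightarrow> nat
    \<Rightarrow> (real \<Rightarrow> nat list \<Rightarrow> nat list \<Rightarrow> real) \<Rightarrow> bool" where
  "admissible b \<gamma> \<psi> q V \<longleftrightarrow>
     (\<forall>u\<in>words b q. \<forall>v\<in>words b q.
        (\<lambda>x. V x u v) \<in> borel_measurable (restrict_space lborel {0..<1})) \<and>
     (\<forall>x\<in>{0..<1}. \<forall>u\<in>words b q. \<forall>v\<in>words b q. V x u v \<ge> 0) \<and>
     (\<exists>\<epsilon>>0. \<exists>\<delta>>0. \<forall>x\<in>{0..<1}. \<forall>u v. (u, v) \<in> Etan b \<gamma> \<psi> q x \<epsilon> \<delta> \<longrightarrow>
        V x u v * V x v u \<ge> 1)"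

definition SigmaVw :: "nat \<Rightarrow> nat \<Rightarrow> (real \<Rightarrow> nat list \<Rightarrow> nat list \<Rightarrow> real) \<Rightarrow> (real \<Rightarrow> real)
    \<Rightarrow> real \<Rightarrow> real" where
  "SigmaVw b q V \<omega> x =
     Max ((\<lambda>u. \<omega> x / \<omega> (xu b q x u) * (\<Sum>v\<in>words b q. V x u v)) ` words b q)"

definition sigma :: "nat \<Rightarrow> real \<Rightarrow> (real \<Rightarrow> real) \<Rightarrow> nat \<Rightarrow> ereal" where
  "sigma b \<gamma> \<psi> q =
     Inf {esssup (restrict_space lebesgue {0..<1}) (\<lambda>x. ereal \<bar>SigmaVw b q V \<omega> x\<bar>) | \<omega> V.
            weight \<omega> \<and> admissible b \<gamma> \<psi> q V}"

end

theory Submission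
  imports Defs
begin

text \<open>
  Taking \<open>\<omega> = 1\<close> and for \<open>V\<close> the indicator of \<open>E(q, J)\<close> on each \<open>b\<close>-adic interval \<open>J\<close> of a fixed level
  gives \<open>\<sigma>(q) \<le> e(q)\<close>, which settles \<open>\<gamma> > 2/5\<close>. For \<open>\<gamma> \<le> 2/5\<close>, tangency at \<open>x\<close> of sequences starting
  with different digits \<open>k, l\<close> forces the points \<open>exp (2\<pi>i(x+k)/5)\<close> and \<open>exp (2\<pi>i(x+l)/5)\<close> to be
  neighbouring vertices of a regular pentagon whose chord is nearly vertical. The difference of
  their imaginary parts can only be compensated if the imaginary parts of the second terms of the
  two series differ a lot; then the real parts of these second terms differ little, which makes the
  chord so vertical that \<open>x\<close> lies within \<open>1/12\<close> of \<open>0\<close>, \<open>1/2\<close> or \<open>1\<close>, with a single possible pair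
  of digits. For these digits the points \<open>x(u)\<close> lie outside these neighbourhoods, so the weight \<open>1\<close>
  on them and \<open>3/2\<close> elsewhere gives \<open>\<sigma>(1) \<le> 3/2\<close>. If \<open>\<gamma> \<le> 3/10\<close>, no tangency remains and \<open>\<sigma>(1) \<le> 1\<close>.
\<close>

section \<open>Geometrically weighted series with bounded coefficients\<close>

lemma summable_power_times_bounded:
  fixes r :: real and a :: "nat \<Rightarrow> real"
  assumes "0 \<le> r" "r < 1" and "\<And>n. \<bar>a n\<bar> \<le> B"
  shows "summable (\<lambda>n. r ^ n * a n)"
proof (rule summable_comparison_test')
  show "summable (\<lambda>n. r ^ n * B)"
    using assms by (intro summable_mult2 summable_geometric) auto
  show "norm (r ^ n * a n) \<le> r ^ n * B" if "n \<ge> 0" for n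
    using assms by (simp add: abs_mult mult_left_mono)
qed

lemma abs_suminf_power_times_bounded_le:
  fixes r :: real and a :: "nat \<Rightarrow> real"
  assumes "0 \<le> r" "r < 1" and a: "\<And>n. \<bar>a n\<bar> \<le> B"
  shows "\<bar>\<Sum>n. r ^ n * a n\<bar> \<le> B / (1 - r)"
proof -
  have g: "(\<lambda>n. r ^ n * B) sums (1 / (1 - r) * B)"
    using assms by (intro sums_mult2 geometric_sums) auto
  have "norm (\<Sum>n. r ^ n * a n) \<le> (\<Sum>n. r ^ n * B)"
  proof (rule norm_suminf_le)
    show "norm (r ^ n * a n) \<le> r ^ n * B" for n
      using assms by (simp add: abs_mult mult_left_mono)
    show "summable (\<lambda>n. r ^ n * B)" using g by (simp add: sums_iff)
  qed
  then show ?thesis using g by (simp add: sums_iff)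
qed

text \<open>Solve for the first term and bound everything from the third term on by a geometric
  series. The second term stays explicit because its actual size is exploited later.\<close>

lemma abs_first_term_le:
  fixes r :: real and a :: "nat \<Rightarrow> real"
  assumes r: "0 \<le> r" "r < 1" and a: "\<And>n. \<bar>a n\<bar> \<le> 2"
  shows "\<bar>a 0\<bar> \<le> \<bar>\<Sum>n. r ^ n * a n\<bar> + r * \<bar>a 1\<bar> + r\<^sup>2 * (2 / (1 - r))"
proof -
  have "(\<Sum>n. r ^ n * a n) = (\<Sum>n. r ^ (n + 2) * a (n + 2)) + (\<Sum>n<2. r ^ n * a n)"
    by (rule suminf_split_initial_segment[OF summable_power_times_bounded[OF r a]])
  also have "(\<Sum>n. r ^ (n + 2) * a (n + 2)) = r\<^sup>2 * (\<Sum>n. r ^ n * a (n + 2))"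
    by (subst suminf_mult[symmetric])
      (use r a in \<open>auto intro!: summable_power_times_bounded simp: power2_eq_square mult_ac\<close>)
  finally have "a 0 = (\<Sum>n. r ^ n * a n) - r * a 1 - r\<^sup>2 * (\<Sum>n. r ^ n * a (n + 2))"
    by (simp add: numeral_2_eq_2)
  moreover have "\<bar>r\<^sup>2 * (\<Sum>n. r ^ n * a (n + 2))\<bar> \<le> r\<^sup>2 * (2 / (1 - r))"
    unfolding abs_mult abs_power2
    by (intro mult_left_mono abs_suminf_power_times_bounded_le r a) auto
  moreover have "\<bar>r * a 1\<bar> = r * \<bar>a 1\<bar>" using r by (simp add: abs_mult)
  ultimately show ?thesis by linarith
qed

section \<open>Tangency as bounds on a sine and a cosine series\<close>

text \<open>One angle serves both series: up to constants and the factors gamma^n and (gamma/b)^n,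
  the n-th terms of S and S' are the imaginary and real part of the same point of the unit
  circle.\<close>

definition phase :: "nat \<Rightarrow> real \<Rightarrow> (nat \<Rightarrow> nat) \<Rightarrow> nat \<Rightarrow> real" where
  "phase b x i n = 2 * pi * ((x + (\<Sum>m\<le>n. real (i m) * real b ^ m)) / real b ^ Suc n)"

lemma S_sine:
  assumes "0 \<le> \<gamma>" "\<gamma> < 1" "\<psi> = (\<lambda>x. - 2 * pi * sin (2 * pi * x))"
  shows "S b \<gamma> \<psi> x i = - 2 * pi * (\<Sum>n. \<gamma> ^ n * sin (phase b x i n))"
proof -
  have "S b \<gamma> \<psi> x i = (\<Sum>n. (- 2 * pi) * (\<gamma> ^ n * sin (phase b x i n)))"
    unfolding S_def assms(3) phase_def by (simp add: mult_ac)
  also have "\<dots> = - 2 * pi * (\<Sum>n. \<gamma> ^ n * sin (phase b x i n))"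
    by (rule suminf_mult[OF summable_power_times_bounded[OF assms(1,2)]]) (rule abs_sin_le_one)
  finally show ?thesis .
qed

text \<open>Termwise differentiation: the inner derivative 2 pi / b^(n+1) turns gamma^n into
  (gamma/b)^n, and this geometric majorant gives uniform convergence.\<close>

lemma Sd_sine:
  assumes b: "b \<ge> 1" and \<gamma>: "0 \<le> \<gamma>" "\<gamma> < 1" and \<psi>: "\<psi> = (\<lambda>x. - 2 * pi * sin (2 * pi * x))"
  shows "Sd b \<gamma> \<psi> x i = - (4 * pi\<^sup>2 / b) * (\<Sum>n. (\<gamma> / b) ^ n * cos (phase b x i n))"
proof -
  define f where "f n y = \<gamma> ^ n * sin (phase b y i n)" for n y
  define f' where "f' n y = (2 * pi / b) * ((\<gamma> / b) ^ n * cos (phase b y i n))" for n y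
  have r: "0 \<le> \<gamma> / b" "\<gamma> / b < 1"
    using b \<gamma> by (auto simp: divide_simps intro: order_less_le_trans)
  have "((\<lambda>y. \<Sum>n. f n y) has_field_derivative (\<Sum>n. f' n x)) (at x)"
  proof (rule has_field_derivative_series'(2))
    show "(f n has_field_derivative f' n y) (at y within UNIV)" for n y
      unfolding f_def f'_def phase_def using b
      by (auto intro!: derivative_eq_intros simp: field_simps power_divide)
    show "uniformly_convergent_on UNIV (\<lambda>n y. \<Sum>m<n. f' m y)"
    proof (rule Weierstrass_m_test')
      show "norm (f' n y) \<le> (2 * pi / b) * (\<gamma> / b) ^ n" for n y
      proof -
        have "(\<gamma> / b) ^ n * \<bar>cos (phase b y i n)\<bar> \<le> (\<gamma> / b) ^ n * 1"
          using r by (intro mult_left_mono) auto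
        then show ?thesis
          unfolding f'_def using \<gamma>
          by (simp add: abs_mult power_abs mult_left_mono divide_right_mono del: times_divide_eq_left)
      qed
      show "summable (\<lambda>n. (2 * pi / b) * (\<gamma> / b) ^ n)"
        using r by (intro summable_mult summable_geometric) auto
    qed
    show "summable (\<lambda>n. f n x)"
      unfolding f_def by (rule summable_power_times_bounded[OF \<gamma>]) (rule abs_sin_le_one)
  qed auto
  then have "((\<lambda>y. - 2 * pi * (\<Sum>n. f n y)) has_field_derivative - 2 * pi * (\<Sum>n. f' n x)) (at x)"
    by (rule DERIV_cmult)
  then have "Sd b \<gamma> \<psi> x i = - 2 * pi * (\<Sum>n. f' n x)"
    unfolding Sd_def S_sine[OF \<gamma> \<psi>] f_def by (rule DERIV_imp_deriv)
  also have "(\<Sum>n. f' n x) = (2 * pi / b) * (\<Sum>n. (\<gamma> / b) ^ n * cos (phase b x i n))"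
    unfolding f'_def
    by (rule suminf_mult[OF summable_power_times_bounded[OF r]]) (rule abs_cos_le_one)
  finally show ?thesis by (simp add: power2_eq_square)
qed

text \<open>The prefactors 2 pi and 4 pi^2 / b are at least 1, so the tolerances carry over to the
  normalised series; for the second one, pi > 3 allows b up to 36.\<close>

lemma tangent_imp_series_le:
  fixes b :: nat
  assumes b: "b \<ge> 1" "b \<le> 36" and \<gamma>: "0 \<le> \<gamma>" "\<gamma> < 1" and \<psi>: "\<psi> = (\<lambda>x. - 2 * pi * sin (2 * pi * x))"
    and t: "tangent b \<gamma> \<psi> \<epsilon> \<delta> x i j"
  shows "\<bar>\<Sum>n. \<gamma> ^ n * (sin (phase b x i n) - sin (phase b x j n))\<bar> \<le> \<epsilon>"
    and "\<bar>\<Sum>n. (\<gamma> / b) ^ n * (cos (phase b x i n) - cos (phase b x j n))\<bar> \<le> \<delta>"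
proof -
  have r: "0 \<le> \<gamma> / b" "\<gamma> / b < 1"
    using b \<gamma> by (auto simp: divide_simps intro: order_less_le_trans)
  let ?s = "\<Sum>n. \<gamma> ^ n * (sin (phase b x i n) - sin (phase b x j n))"
  let ?c = "\<Sum>n. (\<gamma> / b) ^ n * (cos (phase b x i n) - cos (phase b x j n))"
  have s: "?s = (\<Sum>n. \<gamma> ^ n * sin (phase b x i n)) - (\<Sum>n. \<gamma> ^ n * sin (phase b x j n))"
    by (subst suminf_diff) (auto intro!: summable_power_times_bounded[OF \<gamma>] abs_sin_le_one simp: algebra_simps)
  have "S b \<gamma> \<psi> x i - S b \<gamma> \<psi> x j = - 2 * pi * ?s"
    unfolding S_sine[OF \<gamma> \<psi>] s by (simp only: right_diff_distrib)
  moreover have "1 * \<bar>?s\<bar> \<le> (2 * pi) * \<bar>?s\<bar>"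
    using pi_gt3 by (intro mult_right_mono) auto
  ultimately show "\<bar>?s\<bar> \<le> \<epsilon>"
    using t unfolding tangent_def by (simp add: abs_mult)
  have c: "?c = (\<Sum>n. (\<gamma> / b) ^ n * cos (phase b x i n)) - (\<Sum>n. (\<gamma> / b) ^ n * cos (phase b x j n))"
    by (subst suminf_diff) (auto intro!: summable_power_times_bounded[OF r] abs_cos_le_one simp: algebra_simps)
  have "Sd b \<gamma> \<psi> x i - Sd b \<gamma> \<psi> x j = - (4 * pi\<^sup>2 / b) * ?c"
    unfolding Sd_sine[OF b(1) \<gamma> \<psi>] c by (simp only: right_diff_distrib)
  moreover have "1 * \<bar>?c\<bar> \<le> (4 * pi\<^sup>2 / b) * \<bar>?c\<bar>"
  proof (intro mult_right_mono)
    have "3 * 3 \<le> pi * pi" using pi_gt3 by (intro mult_mono) auto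
    then show "1 \<le> 4 * pi\<^sup>2 / b" using b by (simp add: power2_eq_square)
  qed auto
  ultimately show "\<bar>?c\<bar> \<le> \<delta>"
    using t unfolding tangent_def by (simp add: abs_mult)
qed

section \<open>Constants of the regular pentagon\<close>

text \<open>The identity sin(2 pi/5) = sin(3 pi/5) makes c = cos(pi/5) a root of 4c^2 - 2c - 1, and
  this quadratic changes sign between the two bounds.\<close>

lemma cos_pi_fifth_bounds: "0.809 < cos (pi / 5)" "cos (pi / 5) < (0.8091 :: real)"
proof -
  define c s where "c = cos (pi / 5)" and "s = sin (pi / 5)"
  have s: "s > 0" unfolding s_def by (rule sin_gt_zero) auto
  have c: "c > 0" unfolding c_def by (rule cos_gt_zero) auto
  have "sin (2 * (pi / 5)) = sin (3 * (pi / 5))"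
    using sin_pi_minus[of "2 * (pi / 5)"] by (simp add: field_simps)
  also have "sin (3 * (pi / 5)) = sin (2 * (pi / 5) + pi / 5)" by (simp add: field_simps)
  also have "\<dots> = s * (4 * c\<^sup>2 - 1)"
    unfolding sin_add sin_double cos_double_cos c_def s_def
    by (simp add: algebra_simps power2_eq_square)
  finally have "s * (2 * c) = s * (4 * c\<^sup>2 - 1)"
    unfolding sin_double c_def s_def by simp
  with s have e: "4 * c\<^sup>2 - 2 * c - 1 = 0" by simp
  \<comment> \<open>The product is 4c^2 - 2c, which equals 1, minus the value of the same polynomial
    at 0.809.\<close>
  have "(c - 0.809) * (4 * (c + 0.809) - 2) > 0"
    using e by (simp add: algebra_simps power2_eq_square)
  moreover have "c > 1/2"
  proof (rule ccontr)
    assume "\<not> c > 1/2"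
    then have "c * c \<le> (1/2) * c" using c by (intro mult_right_mono) auto
    then show False using e unfolding power2_eq_square by linarith
  qed
  ultimately show "0.809 < cos (pi / 5)" unfolding c_def[symmetric]
    by (simp add: zero_less_mult_iff)
  have "(c - 0.8091) * (4 * (c + 0.8091) - 2) < 0"
    using e by (simp add: algebra_simps power2_eq_square)
  then show "cos (pi / 5) < 0.8091" unfolding c_def[symmetric]
    using \<open>c > 1/2\<close> by (simp add: mult_less_0_iff)
qed

text \<open>Times 4, these bound the squared side (1.3812) and the squared diagonal (3.6) of the
  pentagon inscribed in the unit circle.\<close>

lemma sin_pi_fifths_sq:
  shows "(sin (pi / 5))\<^sup>2 > (0.3453 :: real)" "(sin (2 * pi / 5))\<^sup>2 > (0.9 :: real)"
proof -
  define c where "c = cos (pi / 5)"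
  have b: "0.809 < c" "c < 0.8091" unfolding c_def by (rule cos_pi_fifth_bounds)+
  have "c * c < 0.8091 * 0.8091" using b by (intro mult_strict_mono) auto
  moreover have "0.809 * 0.809 < c * c" using b by (intro mult_strict_mono) auto
  ultimately have c2: "0.65448 < c\<^sup>2" "c\<^sup>2 < 0.6547" by (auto simp: power2_eq_square)
  then show "(sin (pi / 5))\<^sup>2 > (0.3453 :: real)"
    unfolding sin_squared_eq c_def by simp
  define d where "d = cos (2 * pi / 5)"
  have "d = 2 * c\<^sup>2 - 1" unfolding c_def d_def using cos_double_cos[of "pi / 5"] by simp
  then have d: "0.308 < d" "d < 0.31" using c2 by auto
  have "d * d < 0.31 * 0.31" using d by (intro mult_strict_mono) auto
  then show "(sin (2 * pi / 5))\<^sup>2 > (0.9 :: real)"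
    unfolding sin_squared_eq d_def by (simp add: power2_eq_square)
qed

text \<open>Since pi > 3, it is enough to treat sin(1/10), whose Taylor polynomial of degree 2 is
  1/10 with error at most 1/6000.\<close>

lemma sin_pi_over_30: "sin (pi / 30) > (0.098 :: real)"
proof -
  have "sin (pi / 30) \<ge> sin (1/10)"
    using pi_gt3 by (intro sin_monotone_2pi_le) auto
  moreover have "\<bar>sin (1/10) - (\<Sum>m<3. sin_coeff m * (1/10) ^ m)\<bar> \<le> inverse (fact 3) * \<bar>1/10\<bar> ^ (3::nat)"
    by (rule Maclaurin_sin_bound)
  moreover have "(\<Sum>m<3. sin_coeff m * (1/10) ^ m) = (1/10 :: real)"
    "inverse (fact 3) * \<bar>1/10\<bar> ^ 3 = (1/6000 :: real)"
    by (simp_all add: sin_coeff_def eval_nat_numeral)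
  ultimately have "sin (pi / 30) \<ge> 1/10 - 1/6000" by linarith
  then show ?thesis by simp
qed

text \<open>The value depends only on the distance from y to the nearest integer, and increases with
  it on [0, 1/2].\<close>

lemma abs_sin_pi_ge:
  fixes y :: real
  assumes far: "\<And>n::int. \<bar>y - n\<bar> \<ge> 1/30"
  shows "\<bar>sin (pi * y)\<bar> \<ge> sin (pi / 30)"
proof -
  define n z where "n = round y" and "z = \<bar>y - round y\<bar>"
  have z: "1/30 \<le> z" "z \<le> 1/2"
    using far[of n] of_int_round_abs_le[of y] unfolding n_def z_def by (auto simp: abs_minus_commute)
  have "\<bar>sin (pi * y)\<bar> = \<bar>sin (pi * (y - n))\<bar>"
  proof -
    have "pi * y = pi * (y - n) + pi * n" by (simp add: algebra_simps)
    moreover have s: "sin (pi * of_int n) = 0"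
      by (auto simp: sin_times_pi_eq_0 mult.commute)
    moreover have "\<bar>cos (pi * of_int n)\<bar> = 1"
      using sin_cos_squared_add[of "pi * of_int n"] s by (simp add: power2_eq_1_iff abs_if)
    ultimately show ?thesis by (simp add: sin_add abs_mult mult.commute)
  qed
  also have "\<dots> = \<bar>sin (pi * z)\<bar>" unfolding z_def n_def by (cases "y \<ge> round y") (auto simp: abs_if right_diff_distrib sin_diff mult.commute)
  finally have "\<bar>sin (pi * y)\<bar> = \<bar>sin (pi * z)\<bar>" .
  moreover have "sin (pi * z) \<ge> sin (pi * (1/30))"
    using z pi_gt3 by (intro sin_monotone_2pi_le mult_left_mono) (auto simp: field_simps)
  ultimately show ?thesis by simp
qed

section \<open>Tangent sequences with different first digits\<close>

text \<open>Here \<open>s0\<close>, \<open>c0\<close> and \<open>s1\<close>, \<open>c1\<close> are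
  the sine and cosine differences of the first and second terms, and 1/1000 is the tolerance of
  tangency. A crude bound on \<open>c0\<close> makes \<open>s0\<close> large, hence
  \<open>s1\<close> large, hence \<open>c1\<close> small, which improves the bound on
  \<open>c0\<close>.\<close>

lemma near_tangency_estimate:
  fixes g s0 s1 c0 c1 :: real
  assumes g: "0 \<le> g" "g \<le> 2/5"
    and s0: "\<bar>s0\<bar> \<le> 1/1000 + g * \<bar>s1\<bar> + g\<^sup>2 * (2 / (1 - g))"
    and c0: "\<bar>c0\<bar> \<le> 1/1000 + (g / 5) * \<bar>c1\<bar> + (g / 5)\<^sup>2 * (2 / (1 - g / 5))"
    and u: "s1\<^sup>2 + c1\<^sup>2 \<le> 4"
    and chord: "s0\<^sup>2 + c0\<^sup>2 > 1.3812"
  shows "s0\<^sup>2 + c0\<^sup>2 < 3.6" "c0\<^sup>2 < 0.0131" "g > 3/10"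
proof -
  have sq: "t\<^sup>2 \<le> B * B" if "\<bar>t\<bar> \<le> B" for t B :: real
    using that abs_le_square_iff[of t B] by (simp add: power2_eq_square)
  have sq': "\<bar>t\<bar> < B" if "t\<^sup>2 < B * B" "B > 0" for t B :: real
    using that abs_le_square_iff[of B t] by (simp add: power2_eq_square)
  have two: "\<bar>s1\<bar> \<le> 2" "\<bar>c1\<bar> \<le> 2"
    using u abs_le_square_iff[of s1 2] abs_le_square_iff[of c1 2] 
      zero_le_power2[of s1] zero_le_power2[of c1] by (auto simp del: zero_le_power2)
  have tail: "r\<^sup>2 * (2 / (1 - r)) \<le> (R * R) * (2 / (1 - R))" if "0 \<le> r" "r \<le> R" "R < 1" for r R :: real
    using that unfolding power2_eq_square by (intro mult_mono divide_left_mono) auto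
  \<comment> \<open>With ratio at most 2/25 the tail is below 0.01392, so \<open>c0\<close> is small
    whatever the second terms are.\<close>
  have "g / 5 * \<bar>c1\<bar> \<le> 0.08 * \<bar>c1\<bar>" using g by (intro mult_right_mono) auto
  moreover have "(g / 5)\<^sup>2 * (2 / (1 - g / 5)) \<le> 0.01392"
    using tail[of "g / 5" "2/25"] g by simp
  ultimately have c: "\<bar>c0\<bar> \<le> 0.01492 + 0.08 * \<bar>c1\<bar>" using c0 by simp
  then have "\<bar>c0\<bar> \<le> 0.17492" using two by simp
  from sq[OF this] have c2: "c0\<^sup>2 < 0.0306" by simp
  have "g * \<bar>s1\<bar> \<le> 0.4 * \<bar>s1\<bar>" using g by (intro mult_right_mono) auto
  moreover have "g\<^sup>2 * (2 / (1 - g)) \<le> 0.53334"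
    using tail[of g "2/5"] g by simp
  ultimately have s: "\<bar>s0\<bar> \<le> 0.53434 + 0.4 * \<bar>s1\<bar>" using s0 by simp
  then have "\<bar>s0\<bar> \<le> 1.33434" using two by simp
  from sq[OF this] c2 show "s0\<^sup>2 + c0\<^sup>2 < 3.6" by simp
  \<comment> \<open>Otherwise the squared chord would be at most 1.162^2 + 0.0306 < 1.3812. The next
    threshold satisfies 0.53434 + 0.4 * 1.569 < 1.162.\<close>
  have "\<not> \<bar>s0\<bar> \<le> 1.162" using sq[of s0 "1.162"] c2 chord by auto
  then have "\<not> \<bar>s1\<bar> \<le> 1.569" using s by simp
  then have "\<not> s1\<^sup>2 < 1.569 * 1.569" using sq'[of s1 "1.569"] by auto
  \<comment> \<open>Two points of the unit circle are at distance at most 2, and 4 - 1.569^2 <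
    1.2405^2.\<close>
  then have "c1\<^sup>2 < 1.2405 * 1.2405" using u by simp
  from sq'[OF this] have "\<bar>c1\<bar> < 1.2405" by simp
  with c have "\<bar>c0\<bar> \<le> 0.11416" by simp
  from sq[OF this] show "c0\<^sup>2 < 0.0131" by simp
  show "g > 3/10"
  proof (rule ccontr)
    assume "\<not> g > 3/10"
    then have g': "g \<le> 3/10" by simp
    \<comment> \<open>For ratio at most 3/10 even the crude bounds keep the squared chord below the
      pentagon side.\<close>
    have "g * \<bar>s1\<bar> \<le> 0.3 * 2" using g g' two by (intro mult_mono) auto
    moreover have "g\<^sup>2 * (2 / (1 - g)) \<le> 0.26" using tail[of g "3/10"] g g' by simp
    ultimately have "\<bar>s0\<bar> \<le> 0.9" using s0 by simp
    from sq[OF this] c2 chord show False by simp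
  qed
qed

text \<open>Digit differences 1 and 4 give sides of the pentagon, 2 and 3 give diagonals.\<close>

lemma sin_pi_mult_fifth_sq:
  fixes d :: int
  assumes "d \<noteq> 0" "\<bar>d\<bar> \<le> 4"
  shows "(sin (pi * d / 5))\<^sup>2 = (if \<bar>d\<bar> = 1 \<or> \<bar>d\<bar> = 4 then (sin (pi / 5))\<^sup>2 else (sin (2 * pi / 5))\<^sup>2)"
proof -
  have r: "sin (3 * pi / 5) = sin (2 * pi / 5)" "sin (4 * pi / 5) = sin (pi / 5)"
    using sin_pi_minus[of "2 * pi / 5"] sin_pi_minus[of "pi / 5"] by (simp_all add: field_simps)
  have "d \<in> {-4, -3, -2, -1, 1, 2, 3, 4}" using assms by auto
  then show ?thesis using r by (auto simp: mult.commute)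
qed

text \<open>A chord of the unit circle is perpendicular to the direction of the mean angle; the
  second formula gives its horizontal component and so measures how far it is from vertical.\<close>

lemma sin_cos_diff_sq:
  fixes p q :: real
  shows "(sin p - sin q)\<^sup>2 + (cos p - cos q)\<^sup>2 = 4 * (sin ((p - q) / 2))\<^sup>2"
    and "(cos p - cos q)\<^sup>2 = 4 * (sin ((p + q) / 2))\<^sup>2 * (sin ((p - q) / 2))\<^sup>2"
proof -
  have c: "cos p - cos q = - 2 * sin ((p + q) / 2) * sin ((p - q) / 2)"
    unfolding cos_diff_cos using sin_minus[of "(p - q) / 2"] by (simp add: minus_divide_left)
  then show "(cos p - cos q)\<^sup>2 = 4 * (sin ((p + q) / 2))\<^sup>2 * (sin ((p - q) / 2))\<^sup>2"
    by (simp add: power_mult_distrib)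
  show "(sin p - sin q)\<^sup>2 + (cos p - cos q)\<^sup>2 = 4 * (sin ((p - q) / 2))\<^sup>2"
    unfolding c sin_diff_sin power_mult_distrib sin_squared_eq[of "(p + q) / 2"]
    by (simp add: algebra_simps)
qed

lemma tangent_5_imp:
  fixes k l :: nat
  assumes \<gamma>: "0 \<le> \<gamma>" "\<gamma> \<le> 2/5" and \<psi>: "\<psi> = (\<lambda>x. - 2 * pi * sin (2 * pi * x))"
    and t: "tangent 5 \<gamma> \<psi> (1/1000) (1/1000) x (conc [k] u) (conc [l] v)"
    and kl: "k < 5" "l < 5" "k \<noteq> l"
  shows "\<gamma> > 3/10" "\<bar>int k - int l\<bar> \<in> {1, 4}" "\<exists>n::int. \<bar>2 * x + k + l - 5 * n\<bar> < 1/6"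
proof -
  define p q where "p = phase 5 x (conc [k] u)" and "q = phase 5 x (conc [l] v)"
  define s c where "s n = sin (p n) - sin (q n)" and "c n = cos (p n) - cos (q n)" for n
  define d where "d = int k - int l"
  define D where "D = (sin (pi * d / 5))\<^sup>2"
  define M where "M = (sin (pi * ((2 * x + k + l) / 5)))\<^sup>2"
  have "\<gamma> < 1" using \<gamma> by simp
  note series = tangent_imp_series_le[of 5, OF _ _ \<gamma>(1) this \<psi> t, simplified, folded p_def q_def, folded s_def c_def]
  have bd: "\<bar>s n\<bar> \<le> 2" "\<bar>c n\<bar> \<le> 2" for n
    unfolding s_def c_def using abs_sin_le_one[of "p n"] abs_sin_le_one[of "q n"]
      abs_cos_le_one[of "p n"] abs_cos_le_one[of "q n"] by linarith+
  \<comment> \<open>At index 0 the phase sees only the first digit, so the continuations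
    \<open>u\<close> and \<open>v\<close> drop out.\<close>
  have h: "(p 0 - q 0) / 2 = pi * d / 5" "(p 0 + q 0) / 2 = pi * ((2 * x + k + l) / 5)"
    unfolding p_def q_def d_def phase_def conc_def by (simp_all add: field_simps)
  have chord: "(s 0)\<^sup>2 + (c 0)\<^sup>2 = 4 * D" "(c 0)\<^sup>2 = 4 * M * D"
    using sin_cos_diff_sq[of "p 0" "q 0"] unfolding s_def c_def h D_def M_def by simp_all
  have d: "d \<noteq> 0" "\<bar>d\<bar> \<le> 4" using kl unfolding d_def by auto
  have D: "D > 0.3453" "\<bar>d\<bar> \<notin> {1, 4} \<Longrightarrow> D > 0.9"
    unfolding D_def sin_pi_mult_fifth_sq[OF d] using sin_pi_fifths_sq by auto
  have est: "(s 0)\<^sup>2 + (c 0)\<^sup>2 < 3.6" "(c 0)\<^sup>2 < 0.0131" "\<gamma> > 3/10"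
  proof -
    have "\<bar>s 0\<bar> \<le> 1/1000 + \<gamma> * \<bar>s 1\<bar> + \<gamma>\<^sup>2 * (2 / (1 - \<gamma>))"
      using abs_first_term_le[of \<gamma> s] bd \<gamma> series(1) by auto
    moreover have "\<bar>c 0\<bar> \<le> 1/1000 + (\<gamma> / 5) * \<bar>c 1\<bar> + (\<gamma> / 5)\<^sup>2 * (2 / (1 - \<gamma> / 5))"
      using abs_first_term_le[of "\<gamma> / 5" c] bd \<gamma> series(2) by auto
    moreover have "(s 1)\<^sup>2 + (c 1)\<^sup>2 \<le> 4"
      unfolding s_def c_def sin_cos_diff_sq(1) using abs_sin_le_one[of "(p 1 - q 1) / 2"]
      by (simp add: abs_square_le_1)
    moreover have "(s 0)\<^sup>2 + (c 0)\<^sup>2 > 1.3812" using chord D by simp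
    ultimately show "(s 0)\<^sup>2 + (c 0)\<^sup>2 < 3.6" "(c 0)\<^sup>2 < 0.0131" "\<gamma> > 3/10"
      using near_tangency_estimate[OF \<gamma>] by blast+
  qed
  show "\<gamma> > 3/10" by (fact est)
  \<comment> \<open>A diagonal would have squared length above 4 * 0.9 = 3.6.\<close>
  show "\<bar>int k - int l\<bar> \<in> {1, 4}"
    using est(1) D(2) chord(1) unfolding d_def by force
  show "\<exists>n::int. \<bar>2 * x + k + l - 5 * n\<bar> < 1/6"
  proof (rule ccontr)
    assume far: "\<not> ?thesis"
    \<comment> \<open>The chord is vertical when 2x + k + l is a multiple of 5; the margin 1/6
      becomes 1/30 after division by 5.\<close>
    have scale: "\<bar>a / 5 - m\<bar> \<ge> 1/30" if "\<not> \<bar>a - 5 * m\<bar> < 1/6" for a m :: real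
      using that by (simp add: abs_if field_simps split: if_splits)
    have "\<bar>(2 * x + k + l) / 5 - n\<bar> \<ge> 1/30" for n :: int
    proof (rule scale)
      show "\<not> \<bar>2 * x + k + l - 5 * real_of_int n\<bar> < 1/6"
        using far by blast
    qed
    from abs_sin_pi_ge[OF this] sin_pi_over_30
    have "\<bar>sin (pi * ((2 * x + k + l) / 5))\<bar> > 0.098" by simp
    then have "0.098 * 0.098 < \<bar>sin (pi * ((2 * x + k + l) / 5))\<bar> * \<bar>sin (pi * ((2 * x + k + l) / 5))\<bar>"
      by (intro mult_strict_mono) auto
    then have "0.009604 < M" unfolding M_def by (simp add: power2_eq_square)
    \<comment> \<open>Contradiction because 4 * 0.009604 * 0.3453 exceeds 0.0131.\<close>
    then have "0.009604 * 0.3453 < M * D" using D by (intro mult_strict_mono) auto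
    then show False using chord(2) est(2) by simp
  qed
qed

section \<open>Upper bounds for sigma from one weight and one testing function\<close>

lemma finite_words: "finite (words b q)"
  unfolding words_def using finite_lists_length_eq[of "{..<b}" q] by (simp add: conj_commute)

lemma words_1: "words b 1 = (\<lambda>k. [k]) ` {..<b}"
  unfolding words_def by (auto simp: length_Suc_conv)

lemma words_nonempty: "b \<ge> 1 \<Longrightarrow> words b q \<noteq> {}"
  unfolding words_def by (auto intro!: exI[of _ "replicate q 0"])

text \<open>A bound uniform in x and u controls the maximum over u and then the essential supremum.
  Working with Borel functions on the whole line covers both the restricted Borel and the restricted
  Lebesgue measurability.\<close>

lemma sigma_le:
  fixes V :: "real \<Rightarrow> nat list \<Rightarrow> nat list \<Rightarrow> real"
  assumes b: "b \<ge> 1" and \<omega>: "\<omega> \<in> borel_measurable borel"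
    and V: "\<And>u v. u \<in> words b q \<Longrightarrow> v \<in> words b q \<Longrightarrow> (\<lambda>x. V x u v) \<in> borel_measurable borel"
    and w: "m > 0" "\<And>x. x \<in> {0..<1} \<Longrightarrow> m \<le> \<omega> x" "\<And>x. x \<in> {0..<1} \<Longrightarrow> \<omega> x \<le> M"
    and xu: "\<And>x u. x \<in> {0..<1} \<Longrightarrow> u \<in> words b q \<Longrightarrow> 0 < \<omega> (xu b q x u)"
    and V0: "\<And>x u v. x \<in> {0..<1} \<Longrightarrow> u \<in> words b q \<Longrightarrow> v \<in> words b q \<Longrightarrow> 0 \<le> V x u v"
    and \<epsilon>: "\<epsilon> > 0" "\<delta> > 0"
      "\<And>x u v. x \<in> {0..<1} \<Longrightarrow> (u, v) \<in> Etan b \<gamma> \<psi> q x \<epsilon> \<delta> \<Longrightarrow> V x u v * V x v u \<ge> 1"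
    and le: "\<And>x u. x \<in> {0..<1} \<Longrightarrow> u \<in> words b q \<Longrightarrow>
      \<omega> x / \<omega> (xu b q x u) * (\<Sum>v\<in>words b q. V x u v) \<le> C"
  shows "sigma b \<gamma> \<psi> q \<le> ereal C"
proof -
  let ?\<Omega> = "restrict_space lebesgue {0..<1::real}"
  have restr: "f \<in> borel_measurable (restrict_space lborel A)" if "f \<in> borel_measurable borel"
    for f :: "real \<Rightarrow> real" and A
    using that by (intro measurable_restrict_space1) simp
  have "weight \<omega>"
    unfolding weight_def
  proof (intro conjI exI ballI)
    fix x :: real assume x: "x \<in> {0..<1}"
    show "\<omega> x > 0" using w(1) w(2)[OF x] by linarith
    show "\<omega> x \<le> max M (1 / m)" using w(3)[OF x] by simp
    show "1 / \<omega> x \<le> max M (1 / m)" using w(1) w(2)[OF x]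
      by (intro max.coboundedI2 divide_left_mono) auto
  qed (intro restr \<omega>)
  moreover have "admissible b \<gamma> \<psi> q V"
    unfolding admissible_def
  proof (intro conjI ballI)
    show "(\<lambda>x. V x u v) \<in> borel_measurable (restrict_space lborel {0..<1})"
      if "u \<in> words b q" "v \<in> words b q" for u v
      using that by (intro restr V)
    show "\<exists>\<epsilon>>0. \<exists>\<delta>>0. \<forall>x\<in>{0..<1}. \<forall>u v.
        (u, v) \<in> Etan b \<gamma> \<psi> q x \<epsilon> \<delta> \<longrightarrow> V x u v * V x v u \<ge> 1"
      using \<epsilon> by (intro exI[of _ \<epsilon>] conjI exI[of _ \<delta>]) auto
  qed (rule V0)
  ultimately have "sigma b \<gamma> \<psi> q \<le> esssup ?\<Omega> (\<lambda>x. ereal \<bar>SigmaVw b q V \<omega> x\<bar>)"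
    unfolding sigma_def by (intro Inf_lower) auto
  also have "\<dots> \<le> ereal C"
  proof (rule esssup_I)
    note [measurable] = \<omega>
    have [measurable]: "(\<lambda>x. xu b q x u) \<in> borel_measurable borel" for u
      unfolding xu_def by measurable
    have "(\<lambda>x. \<Sum>v\<in>words b q. V x u v) \<in> borel_measurable borel" if "u \<in> words b q" for u
      using that V by (intro borel_measurable_sum) auto
    then have "(\<lambda>x. \<omega> x / \<omega> (xu b q x u) * (\<Sum>v\<in>words b q. V x u v)) \<in> borel_measurable borel"
      if "u \<in> words b q" for u
      using that by (intro borel_measurable_times) auto
    then have "SigmaVw b q V \<omega> \<in> borel_measurable borel"
      unfolding SigmaVw_def using finite_words by (intro borel_measurable_Max) auto
    then have "SigmaVw b q V \<omega> \<in> borel_measurable ?\<Omega>"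
      by (intro measurable_restrict_space1 measurable_completion) simp
    then show "(\<lambda>x. ereal \<bar>SigmaVw b q V \<omega> x\<bar>) \<in> borel_measurable ?\<Omega>" by measurable
    have "\<bar>SigmaVw b q V \<omega> x\<bar> \<le> C" if x: "x \<in> {0..<1}" for x
    proof -
      let ?f = "\<lambda>u. \<omega> x / \<omega> (xu b q x u) * (\<Sum>v\<in>words b q. V x u v)"
      \<comment> \<open>The maximum is attained at a nonnegative value, so the absolute value
        disappears.\<close>
      have "SigmaVw b q V \<omega> x \<in> ?f ` words b q"
        unfolding SigmaVw_def by (rule Max_in) (use finite_words words_nonempty[OF b] in auto)
      then obtain u where u: "u \<in> words b q" "SigmaVw b q V \<omega> x = ?f u" by auto
      have "0 \<le> ?f u"
        using w(1) w(2)[OF x] xu[OF x u(1)] V0[OF x u(1)]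
        by (intro mult_nonneg_nonneg divide_nonneg_pos sum_nonneg) auto
      with u le[OF x u(1)] show ?thesis by simp
    qed
    then show "AE x in ?\<Omega>. ereal \<bar>SigmaVw b q V \<omega> x\<bar> \<le> ereal C"
      by (intro AE_I2) (auto simp: space_restrict_space)
  qed
  finally show ?thesis .
qed

lemma Etan_words: "(u, v) \<in> Etan b \<gamma> \<psi> q x \<epsilon> \<delta> \<Longrightarrow> u \<in> words b q \<and> v \<in> words b q"
  unfolding Etan_def by auto

lemma Etan_sym: "(u, v) \<in> Etan b \<gamma> \<psi> q x \<epsilon> \<delta> \<Longrightarrow> (v, u) \<in> Etan b \<gamma> \<psi> q x \<epsilon> \<delta>"
  unfolding Etan_def tangent_def by (auto simp: abs_minus_commute)

lemma Etan_mono: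
  "\<epsilon> \<le> \<epsilon>' \<Longrightarrow> \<delta> \<le> \<delta>' \<Longrightarrow> Etan b \<gamma> \<psi> q x \<epsilon> \<delta> \<subseteq> Etan b \<gamma> \<psi> q x \<epsilon>' \<delta>'"
  unfolding Etan_def tangent_def by (blast intro: order_trans)

section \<open>Comparison of sigma(q) with e(q)\<close>

text \<open>The sets whose intersection is E(q, J) shrink with the tolerances and contain only pairs
  from a finite set, so they stabilise at some positive tolerance.\<close>

lemma EJ_eq_at_small_scale:
  obtains t where "t > 0" "\<And>x. x \<in> J \<Longrightarrow> Etan b \<gamma> \<psi> q x t t \<subseteq> EJ b \<gamma> \<psi> q J"
proof -
  define P where "P = words b q \<times> words b q"
  define U where "U t = (\<Union>x\<in>J. Etan b \<gamma> \<psi> q x t t)" for t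
  have U_mono: "U s \<subseteq> U t" if "s \<le> t" for s t
    unfolding U_def by (intro UN_mono Etan_mono that order_refl)
  have "\<exists>t>0. p \<notin> U t" if "p \<notin> EJ b \<gamma> \<psi> q J" for p
  proof -
    from that obtain \<epsilon> \<delta> where e: "\<epsilon> > 0" "\<delta> > 0" "p \<notin> (\<Union>x\<in>J. Etan b \<gamma> \<psi> q x \<epsilon> \<delta>)"
      unfolding EJ_def by auto
    have "U (min \<epsilon> \<delta>) \<subseteq> (\<Union>x\<in>J. Etan b \<gamma> \<psi> q x \<epsilon> \<delta>)"
      unfolding U_def by (intro UN_mono Etan_mono) auto
    with e(3) have "p \<notin> U (min \<epsilon> \<delta>)" by blast
    moreover have "min \<epsilon> \<delta> > 0" using e by simp
    ultimately show ?thesis by blast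
  qed
  then obtain T where T: "\<And>p. p \<notin> EJ b \<gamma> \<psi> q J \<Longrightarrow> T p > 0 \<and> p \<notin> U (T p)" by metis
  \<comment> \<open>Inserting 1 keeps the set nonempty when E(q, J) already contains all
    pairs.\<close>
  define t where "t = Min (insert 1 (T ` (P - EJ b \<gamma> \<psi> q J)))"
  have fin: "finite (insert 1 (T ` (P - EJ b \<gamma> \<psi> q J)))"
    unfolding P_def using finite_words by blast
  show thesis
  proof
    show "t > 0" unfolding t_def using fin T by (subst Min_gr_iff) auto
    fix x assume x: "x \<in> J"
    show "Etan b \<gamma> \<psi> q x t t \<subseteq> EJ b \<gamma> \<psi> q J"
    proof
      fix p assume p: "p \<in> Etan b \<gamma> \<psi> q x t t"
      show "p \<in> EJ b \<gamma> \<psi> q J"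
      proof (rule ccontr)
        assume n: "p \<notin> EJ b \<gamma> \<psi> q J"
        then have "p \<in> P - EJ b \<gamma> \<psi> q J" using p Etan_words unfolding P_def by (cases p) blast
        then have "t \<le> T p" unfolding t_def using fin by (intro Min_le) auto
        with p x U_mono have "p \<in> U (T p)" unfolding U_def by blast
        with T[OF n] show False by blast
      qed
    qed
  qed
qed

lemma sigma_le_e_seq:
  assumes b: "b \<ge> 1"
  shows "sigma b \<gamma> \<psi> q \<le> ereal (e_seq b \<gamma> \<psi> q p)"
proof -
  define N where "N = b ^ p"
  have N: "N \<ge> 1" unfolding N_def using b by simp
  define J where "J k = {real k / real b ^ p .. (real k + 1) / real b ^ p}" for k
  define cell where "cell x = nat \<lfloor>x * N\<rfloor>" for x :: real
  have cell: "cell x < N" "x \<in> J (cell x)" if x: "x \<in> {0..<1}" for x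
  proof -
    have f: "0 \<le> \<lfloor>x * N\<rfloor>" using x N by simp
    have "x * N < 1 * real N" using x N by (intro mult_strict_right_mono) auto
    with f show "cell x < N" unfolding cell_def by (simp add: nat_less_iff floor_less_iff)
    have "real (cell x) = \<lfloor>x * N\<rfloor>" unfolding cell_def using f by simp
    then have "real (cell x) \<le> x * N" "x * N \<le> real (cell x) + 1" by linarith+
    then show "x \<in> J (cell x)" unfolding J_def using N
      by (simp add: N_def[symmetric] divide_simps flip: of_nat_power)
  qed
  have "\<exists>t. \<forall>k. t k > 0 \<and> (\<forall>x\<in>J k. Etan b \<gamma> \<psi> q x (t k) (t k) \<subseteq> EJ b \<gamma> \<psi> q (J k))"
    by (intro choice allI) (rule EJ_eq_at_small_scale, blast)
  then obtain t where t: "\<And>k. t k > 0"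
    "\<And>k x. x \<in> J k \<Longrightarrow> Etan b \<gamma> \<psi> q x (t k) (t k) \<subseteq> EJ b \<gamma> \<psi> q (J k)" by blast
  \<comment> \<open>There are finitely many cells of level p, so one tolerance serves all of
    them.\<close>
  define s where "s = Min (t ` {..<N})"
  have s: "s > 0" "\<And>k. k < N \<Longrightarrow> s \<le> t k"
    unfolding s_def using t(1) N by (auto simp: lessThan_empty_iff)
  define V where "V x u v = (if (u, v) \<in> EJ b \<gamma> \<psi> q (J (cell x)) then 1 else 0 :: real)" for x u v
  show ?thesis
  proof (rule sigma_le[where \<omega> = "\<lambda>_. 1" and m = 1 and M = 1 and V = V and \<epsilon> = s and \<delta> = s])
    show "(\<lambda>x. V x u v) \<in> borel_measurable borel" for u v
    proof -
      \<comment> \<open>\<open>V\<close> depends on x only through the discrete cell index.\<close>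
      have "cell \<in> borel \<rightarrow>\<^sub>M count_space UNIV" unfolding cell_def by measurable
      then show ?thesis unfolding V_def
        by (rule measurable_compose[where g = "\<lambda>k. if (u, v) \<in> EJ b \<gamma> \<psi> q (J k) then 1 else 0"]) simp
    qed
  next
    fix x :: real and u v assume x: "x \<in> {0..<1}" and uv: "(u, v) \<in> Etan b \<gamma> \<psi> q x s s"
    have "Etan b \<gamma> \<psi> q x s s \<subseteq> EJ b \<gamma> \<psi> q (J (cell x))"
      using t(2)[OF cell(2)[OF x]] s(2)[OF cell(1)[OF x]] Etan_mono by blast
    then show "V x u v * V x v u \<ge> 1"
      unfolding V_def using uv Etan_sym[OF uv] by auto
  next
    fix x :: real and u assume x: "x \<in> {0..<1}" and u: "u \<in> words b q"
    \<comment> \<open>A row sum of the indicator counts the partners of u, which is what e(q, J)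
      maximises.\<close>
    have "(\<Sum>v\<in>words b q. V x u v) = card {v \<in> words b q. (u, v) \<in> EJ b \<gamma> \<psi> q (J (cell x))}"
      unfolding V_def using finite_words by (simp add: sum.If_cases Int_def)
    also have "\<dots> \<le> eJ b \<gamma> \<psi> q (J (cell x))"
      unfolding eJ_def using u finite_words by (intro of_nat_mono Max_ge) auto
    also have "\<dots> \<le> e_seq b \<gamma> \<psi> q p"
      unfolding e_seq_def J_def using cell(1)[OF x] by (intro of_nat_mono Max_ge) (auto simp: N_def)
    finally show "1 / 1 * (\<Sum>v\<in>words b q. V x u v) \<le> real (e_seq b \<gamma> \<psi> q p)" by simp
  qed (use b s in \<open>auto simp: V_def\<close>)
qed

section \<open>Test functions for gamma at most 2/5\<close>

text \<open>The solutions of |2x + k + l - 5| < 1/6 with digits differing by 1 or 4: the sum k + l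
  is 5, 4, 3 for x near 0, 1/2, 1 respectively.\<close>

definition tangent_pair :: "real \<Rightarrow> nat list set" where
  "tangent_pair x =
    (if x < 1/12 then {[2], [3]}
     else if 5/12 < x \<and> x < 7/12 then {[0], [4]}
     else if 11/12 < x then {[1], [2]}
     else {})"

lemma Etan_5_imp_tangent_pair:
  assumes \<gamma>: "0 \<le> \<gamma>" "\<gamma> \<le> 2/5" and \<psi>: "\<psi> = (\<lambda>x. - 2 * pi * sin (2 * pi * x))"
    and x: "x \<in> {0..<1}" and uv: "(u, v) \<in> Etan 5 \<gamma> \<psi> 1 x (1/1000) (1/1000)" "u \<noteq> v"
  shows "\<gamma> > 3/10" "u \<in> tangent_pair x" "v \<in> tangent_pair x"
proof -
  obtain k l i j where kl: "u = [k]" "v = [l]" "k < 5" "l < 5" "k \<noteq> l"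
    and t: "tangent 5 \<gamma> \<psi> (1/1000) (1/1000) x (conc [k] i) (conc [l] j)"
    using uv unfolding Etan_def words_1 by auto
  note T = tangent_5_imp[OF \<gamma> \<psi> t kl(3-5)]
  show "\<gamma> > 3/10" by (fact T(1))
  obtain n :: int where n: "\<bar>2 * x + k + l - 5 * n\<bar> < 1/6" using T(3) by auto
  \<comment> \<open>Distinct digits have sum between 1 and 7, so 2x + k + l lies in [1, 9), and 5 is
    the only multiple of 5 that can be within 1/6 of it.\<close>
  have "1 \<le> k + l" "k + l \<le> 7" using kl T(2) by auto
  then have "1 \<le> real k + real l" "real k + real l \<le> 7" by linarith+
  moreover have "0 \<le> x" "x < 1" using x by auto
  ultimately have "real_of_int n < 2" "real_of_int n > 0" using n by linarith+
  then have "n = 1" by linarith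
  with n have n1: "\<bar>2 * x + k + l - 5\<bar> < 1/6" by simp
  have "k \<in> {0, 1, 2, 3, 4}" "l \<in> {0, 1, 2, 3, 4}" using kl by auto
  then show "u \<in> tangent_pair x" "v \<in> tangent_pair x"
    using n1 x T(2) unfolding kl(1,2) tangent_pair_def by (auto simp: abs_if split: if_splits)
qed

text \<open>The points x(u) fall between the exceptional intervals, touching their endpoints 1/12,
  5/12, 7/12, 11/12 only in the limit. The radius 1/12 is the largest possible: the digit 0 at 1/2 -
  r requires (1/2 - r)/5 \<ge> r.\<close>

lemma tangent_pair_child_empty:
  assumes "x \<in> {0..<1}" "u \<in> tangent_pair x"
  shows "tangent_pair (xu 5 1 x u) = {}"
  using assms unfolding tangent_pair_def xu_def by (auto split: if_splits)

text \<open>Distinct digits are never tangent here, so the identity matrix is admissible and its row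
  sums are 1.\<close>

lemma sigma_5_le_of_small_gamma:
  assumes \<gamma>: "0 \<le> \<gamma>" "\<gamma> \<le> 3/10" and \<psi>: "\<psi> = (\<lambda>x. - 2 * pi * sin (2 * pi * x))"
  shows "sigma 5 \<gamma> \<psi> 1 \<le> ereal 1"
proof (rule sigma_le[where \<omega> = "\<lambda>_. 1" and m = 1 and M = 1 and \<epsilon> = "1/1000" and \<delta> = "1/1000"
      and V = "\<lambda>x u v. if u = v then 1 else 0"])
  fix x :: real and u v assume x: "x \<in> {0..<1}" and E: "(u, v) \<in> Etan 5 \<gamma> \<psi> 1 x (1/1000) (1/1000)"
  have "u = v" using Etan_5_imp_tangent_pair(1)[OF \<gamma>(1) _ \<psi> x E] \<gamma> by fastforce
  then show "1 \<le> (if u = v then 1 else 0) * (if v = u then 1 else 0 :: real)" by simp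
qed (use finite_words in auto)

lemma sigma_5_le:
  assumes \<gamma>: "0 \<le> \<gamma>" "\<gamma> \<le> 2/5" and \<psi>: "\<psi> = (\<lambda>x. - 2 * pi * sin (2 * pi * x))"
  shows "sigma 5 \<gamma> \<psi> 1 \<le> ereal (3/2)"
proof -
  \<comment> \<open>A value w > 1 off the exceptional intervals yields the bound max(2/w, w); w =
    3/2 is enough, since 5 gamma > 3/2 once gamma > 3/10.\<close>
  define \<omega> where "\<omega> x = (if tangent_pair x = {} then 3/2 else 1 :: real)" for x
  define V where "V x u v = (if u = v \<or> u \<in> tangent_pair x \<and> v \<in> tangent_pair x then 1 else 0 :: real)"
    for x u v
  have meas: "tangent_pair \<in> borel \<rightarrow>\<^sub>M count_space UNIV"
    unfolding tangent_pair_def by measurable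
  show ?thesis
  proof (rule sigma_le[where \<omega> = \<omega> and m = 1 and M = "3/2" and \<epsilon> = "1/1000" and \<delta> = "1/1000" and V = V])
    show "\<omega> \<in> borel_measurable borel"
      unfolding \<omega>_def by (rule measurable_compose[OF meas]) simp
    show "(\<lambda>x. V x u v) \<in> borel_measurable borel" for u v
      unfolding V_def
      by (rule measurable_compose[OF meas, where g = "\<lambda>P. if u = v \<or> u \<in> P \<and> v \<in> P then 1 else 0"]) simp
  next
    fix x :: real and u v assume x: "x \<in> {0..<1}" and E: "(u, v) \<in> Etan 5 \<gamma> \<psi> 1 x (1/1000) (1/1000)"
    show "V x u v * V x v u \<ge> 1"
      using Etan_5_imp_tangent_pair(2,3)[OF \<gamma> \<psi> x E] unfolding V_def by auto
  next
    fix x :: real and u assume x: "x \<in> {0..<1}" and u: "u \<in> words 5 1"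
    let ?N = "{v \<in> words 5 1. u = v \<or> u \<in> tangent_pair x \<and> v \<in> tangent_pair x}"
    have sum: "(\<Sum>v\<in>words 5 1. V x u v) = card ?N"
      unfolding V_def using finite_words by (simp add: sum.If_cases Int_def)
    show "\<omega> x / \<omega> (xu 5 1 x u) * (\<Sum>v\<in>words 5 1. V x u v) \<le> 3/2"
    proof (cases "u \<in> tangent_pair x")
      case True
      have "finite (tangent_pair x)" "card (tangent_pair x) \<le> 2" unfolding tangent_pair_def by auto
      moreover have "card ?N \<le> card (tangent_pair x)"
        using True \<open>finite (tangent_pair x)\<close> by (intro card_mono) auto
      ultimately have "real (card ?N) \<le> 2" by simp
      moreover have "\<omega> x = 1" using True unfolding \<omega>_def by auto
      moreover have "\<omega> (xu 5 1 x u) = 3/2"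
        using tangent_pair_child_empty[OF x True] unfolding \<omega>_def by simp
      ultimately show ?thesis unfolding sum by (simp only:) simp
    next
      case False
      \<comment> \<open>The row sum is 1 and the quotient of weights is at most 3/2.\<close>
      then have "?N = {u}" using u by auto
      then show ?thesis unfolding sum by (simp add: \<omega>_def)
    qed
  qed (auto simp: \<omega>_def V_def)
qed

theorem theorem4p2:
  fixes \<gamma> :: real and \<psi> :: "real \<Rightarrow> real"
  assumes "1/5 < \<gamma>" and "\<gamma> < 1"
    and "\<psi> = (\<lambda>x. - 2 * pi * sin (2 * pi * x))"
    and "(\<lambda>p. real (e_seq 5 \<gamma> \<psi> 1 p)) \<longlonglongrightarrow> 2"
  shows "sigma 5 \<gamma> \<psi> 1 < ereal (5 * \<gamma>)"
proof -
  \<comment> \<open>The bounds 1, 3/2 and 2 are compared with 5 gamma on the ranges above 1/5, 3/10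
    and 2/5.\<close>
  consider "\<gamma> \<le> 3/10" | "3/10 < \<gamma>" "\<gamma> \<le> 2/5" | "2/5 < \<gamma>" by linarith
  then show ?thesis
  proof cases
    case 1
    then have "sigma 5 \<gamma> \<psi> 1 \<le> ereal 1"
      using assms(1) by (intro sigma_5_le_of_small_gamma assms(3)) auto
    also have "\<dots> < ereal (5 * \<gamma>)" using assms(1) by simp
    finally show ?thesis .
  next
    case 2
    then have "sigma 5 \<gamma> \<psi> 1 \<le> ereal (3/2)"
      by (intro sigma_5_le assms(3)) auto
    also have "\<dots> < ereal (5 * \<gamma>)" using 2 by simp
    finally show ?thesis .
  next
    case 3
    then have "2 < 5 * \<gamma>" by simp
    from order_tendstoD(2)[OF assms(4) this]
    obtain p where "real (e_seq 5 \<gamma> \<psi> 1 p) < 5 * \<gamma>"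
      using eventually_happens sequentially_bot by blast
    moreover have "sigma 5 \<gamma> \<psi> 1 \<le> ereal (e_seq 5 \<gamma> \<psi> 1 p)"
      by (rule sigma_le_e_seq) simp
    ultimately show ?thesis by (meson ereal_less_eq(3) less_ereal.simps(1) order_le_less_trans)
  qed
qed

end
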